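(* Let $M$ be a positive integer, let $\zeta > 0$, and let $\gamma \sim \mathrm{Gamma}(M,\zeta)$. Let $g(\gamma) = 1+\gamma$. Then for every $s \in \mathbb{R}$ the Mellin transform of $g(\gamma)$ satisfies $$\mathcal{M}_{g(\gamma)}(s) = \frac{e^{1/\zeta}}{\zeta^M\Gamma(M)}\sum_{j=0}^{M-1}\binom{M-1}{j}(-1)^{M-1-j}\,\zeta^{j+s}\,\Gamma(j+s,\zeta^{-1})$$ $$= e^{1/\zeta}\sum_{j=0}^{M-1}(-1)^{M-1-j}\,\zeta^{j+s-M}\,\frac{\Gamma(j+s,\zeta^{-1})}{\Gamma(M-j)\Gamma(j+1)}.$$
   Context: $\mathrm{Gamma}(M,\zeta)$ is the gamma distribution with shape parameter $M$ and scale parameter $\zeta$, i.e. with density $f_\gamma(x) = \frac{x^{M-1}e^{-x/\zeta}}{\Gamma(M)\zeta^M}$ for $x \ge 0$. The Mellin transform of a nonnegative random variable $X$ is $\mathcal{M}_X(s) = \mathbb{E}[X^{s-1}]$; it is considered for real $s$ for which the expectation exists. $\Gamma(a,z) = \int_z^\infty t^{a-1}e^{-t}\,\mathrm{d}t$ (for $a\in\mathbb{R}$, $z>0$) is the upper incomplete gamma function. *)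

theory Defs
  imports "HOL-Probability.Probability"
begin

definition gamma_density :: "nat \<Rightarrow> real \<Rightarrow> real \<Rightarrow> real" where
  "gamma_density M \<zeta> x =
     (if x < 0 then 0 else x ^ (M - 1) * exp (- x / \<zeta>) / (Gamma (real M) * \<zeta> ^ M))"

(* With integer shape this is the library's Erlang density, up to parametrisation:
   the library takes shape minus one and the rate instead of the scale. *)
lemma gamma_density_eq_erlang_density:
  assumes "M \<ge> 1" "\<zeta> > 0"
  shows "gamma_density M \<zeta> = erlang_density (M - 1) (1 / \<zeta>)"
proof -
  obtain k where k: "M = Suc k"
    using assms(1) by (cases M) auto
  have "Gamma (real M) = fact k"
    using Gamma_fact[of k, where 'a = real] by (simp add: k add.commute)
  then show ?thesis
    using assms(2) by (intro ext) (simp add: gamma_density_def erlang_density_def k field_simps)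
qed

(* For nonnegative X. In HOL 0 powr r = 0 for every r, so this is E[X^(s-1)] in the usual sense
   when X > 0 almost surely or s > 1. The Bochner integral is 0 when the expectation does not
   exist, so existence is a separate predicate. *)
definition mellin_transform :: "'a measure \<Rightarrow> ('a \<Rightarrow> real) \<Rightarrow> real \<Rightarrow> real" where
  "mellin_transform P X s = (\<integral>\<omega>. X \<omega> powr (s - 1) \<partial>P)"

definition mellin_exists :: "'a measure \<Rightarrow> ('a \<Rightarrow> real) \<Rightarrow> real \<Rightarrow> bool" where
  "mellin_exists P X s \<longleftrightarrow> integrable P (\<lambda>\<omega>. X \<omega> powr (s - 1))"

definition upper_incomplete_gamma :: "real \<Rightarrow> real \<Rightarrow> real" where
  "upper_incomplete_gamma a z = (LBINT t:{z..}. t powr (a - 1) * exp (- t))"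

end

theory Submission
  imports Defs
begin

text \<open>
  The substitution \<open>x = \<zeta> t - 1\<close> turns \<open>1 + x\<close> into \<open>\<zeta> t\<close>, the exponential into
  \<open>exp (1 / \<zeta>) * exp (- t)\<close> and the half-line \<open>x \<ge> 0\<close> into \<open>t \<ge> 1 / \<zeta>\<close>. Expanding
  \<open>(\<zeta> t - 1) ^ (M - 1)\<close> by the binomial theorem then leaves a sum of incomplete gamma integrals.
\<close>

text \<open>Splitting off \<open>t ^ n\<close> leaves the exponent
  \<open>b - real n \<le> 0\<close>, for which \<open>powr\<close> is antitone on the positive
  reals, so its value at \<open>z\<close> is an upper bound. Integrands with an arbitrary real
  exponent are thus dominated by ones with a natural exponent.\<close>

lemma powr_le_const_mult_power:
  fixes b t z :: real
  assumes "z > 0" "z \<le> t" "b \<le> real n"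
  shows "t powr b \<le> z powr (b - real n) * t ^ n"
proof -
  have "t powr b = t powr (b - real n) * t ^ n"
    using assms by (simp add: powr_diff powr_realpow)
  also have "\<dots> \<le> z powr (b - real n) * t ^ n"
    using assms by (intro mult_right_mono powr_mono2') auto
  finally show ?thesis .
qed

lemma integrable_power_times_exp_Ici:
  "integrable lborel (\<lambda>t::real. t ^ n * exp (- t) * indicator {0..} t)"
proof (rule integrableI_nonneg)
  have "(\<integral>\<^sup>+t. ennreal (t ^ n * exp (- t) * indicator {0..} t) \<partial>lborel)
      = (\<integral>\<^sup>+t. ennreal (t ^ n * exp (- t)) * indicator {0..} t \<partial>lborel)"
    by (intro nn_integral_cong) (auto split: split_indicator)
  then show "(\<integral>\<^sup>+t. ennreal (t ^ n * exp (- t) * indicator {0..} t) \<partial>lborel) < \<infinity>"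
    by (simp add: nn_intergal_power_times_exp_Ici)
qed (auto split: split_indicator)

text \<open>The cutoff \<open>z > 0\<close> stays away from a possible singularity at
  \<open>0\<close>, so the integral converges for every real \<open>a\<close>, negative ones
  included. The form \<open>has_bochner_integral\<close> carries existence and value together
  through the finite sum and the change of variables.\<close>

lemma has_bochner_integral_upper_incomplete_gamma:
  assumes "z > 0"
  shows "has_bochner_integral lborel
    (\<lambda>t. indicator {z..} t * (t powr (a - 1) * exp (- t))) (upper_incomplete_gamma a z)"
proof -
  \<comment> \<open>Any natural number at least \<open>a - 1\<close> serves as the dominating
    exponent; for \<open>a \<le> 0\<close> this choice is \<open>0\<close>.\<close>
  define n where "n = nat \<lceil>a\<rceil>"
  have n: "a - 1 \<le> real n"
    unfolding n_def by linarith
  have "integrable lborel (\<lambda>t. indicator {z..} t * (t powr (a - 1) * exp (- t)))"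
  proof (rule Bochner_Integration.integrable_bound)
    show "integrable lborel
        (\<lambda>t. z powr (a - 1 - real n) * (t ^ n * exp (- t) * indicator {0..} t))"
      by (intro integrable_mult_right integrable_power_times_exp_Ici)
    show "AE t in lborel. norm (indicator {z..} t * (t powr (a - 1) * exp (- t)))
        \<le> norm (z powr (a - 1 - real n) * (t ^ n * exp (- t) * indicator {0..} t))"
    proof (rule AE_I2)
      fix t :: real
      show "norm (indicator {z..} t * (t powr (a - 1) * exp (- t)))
        \<le> norm (z powr (a - 1 - real n) * (t ^ n * exp (- t) * indicator {0..} t))"
        using powr_le_const_mult_power[OF assms _ n, of t] assms
        by (auto split: split_indicator simp: abs_mult mult.assoc[symmetric])
    qed
  qed measurable
  then show ?thesis
    by (simp add: has_bochner_integral_iff upper_incomplete_gamma_def set_lebesgue_integral_def)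
qed

lemma gamma_density_nonneg: "\<zeta> > 0 \<Longrightarrow> 0 \<le> gamma_density M \<zeta> x"
  \<comment> \<open>For \<open>M = 0\<close> the density is \<open>0\<close> everywhere:
    \<open>Gamma 0 = 0\<close>, and division by zero yields \<open>0\<close>.\<close>
  by (cases "M = 0") (auto simp: gamma_density_def 
      intro!: divide_nonneg_nonneg mult_nonneg_nonneg less_imp_le[OF Gamma_real_pos])

text \<open>The argument \<open>-1 + \<zeta> * t\<close> stays unsimplified because the affine
  change of variables produces exactly this form. The indicator records that the density vanishes
  for \<open>t < 1 / \<zeta>\<close>, and the exponent \<open>real j + s - 1\<close> of
  \<open>\<zeta>\<close> is one short because the Jacobian is still missing.\<close>

lemma gamma_density_substitution:
  assumes "\<zeta> > 0"
  shows "gamma_density M \<zeta> (-1 + \<zeta> * t) * (1 + (-1 + \<zeta> * t)) powr (s - 1) =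
    exp (1 / \<zeta>) / (\<zeta> ^ M * Gamma (real M)) *
      (\<Sum>j = 0..M - 1. real ((M - 1) choose j) * (- 1) ^ (M - 1 - j) * \<zeta> powr (real j + s - 1)
        * (indicator {1 / \<zeta>..} t * (t powr (real j + s - 1) * exp (- t))))"
proof (cases "1 / \<zeta> \<le> t")
  case True
  then have t: "t > 0"
    using assms by (smt (verit) divide_pos_pos)
  have x: "\<not> -1 + \<zeta> * t < 0"
    using True assms by (simp add: field_simps)
  have e: "exp (- (-1 + \<zeta> * t) / \<zeta>) = exp (1 / \<zeta>) * exp (- t)"
    using assms by (simp add: exp_add[symmetric] field_simps)
  have "(-1 + \<zeta> * t) ^ (M - 1) * (\<zeta> * t) powr (s - 1) =
      (\<Sum>j = 0..M - 1. real ((M - 1) choose j) * (- 1) ^ (M - 1 - j)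
        * ((\<zeta> * t) ^ j * (\<zeta> * t) powr (s - 1)))"
    using binomial_ring[of "\<zeta> * t" "-1" "M - 1"]
    by (simp add: sum_distrib_left sum_distrib_right atMost_atLeast0 ac_simps)
  also have "\<dots> = (\<Sum>j = 0..M - 1. real ((M - 1) choose j) * (- 1) ^ (M - 1 - j)
        * (\<zeta> powr (real j + s - 1) * t powr (real j + s - 1)))"
  proof (intro sum.cong refl)
    fix j
    \<comment> \<open>Since \<open>0 ^ 0 = 1\<close> but \<open>0 powr 0 = 0\<close>, merging the
      two powers relies on \<open>\<zeta> * t > 0\<close>.\<close>
    have "(\<zeta> * t) ^ j * (\<zeta> * t) powr (s - 1) = (\<zeta> * t) powr (real j + s - 1)"
      using assms t by (simp add: powr_realpow[symmetric] powr_add[symmetric] add_diff_eq)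
    also have "\<dots> = \<zeta> powr (real j + s - 1) * t powr (real j + s - 1)"
      using assms t by (simp add: powr_mult)
    finally show "real ((M - 1) choose j) * (- 1) ^ (M - 1 - j)
        * ((\<zeta> * t) ^ j * (\<zeta> * t) powr (s - 1)) = real ((M - 1) choose j) * (- 1) ^ (M - 1 - j)
        * (\<zeta> powr (real j + s - 1) * t powr (real j + s - 1))"
      by simp
  qed
  finally have sum: "(-1 + \<zeta> * t) ^ (M - 1) * (\<zeta> * t) powr (s - 1) = \<dots>" .
  have "gamma_density M \<zeta> (-1 + \<zeta> * t) * (1 + (-1 + \<zeta> * t)) powr (s - 1) =
      exp (1 / \<zeta>) / (\<zeta> ^ M * Gamma (real M)) *
        (((-1 + \<zeta> * t) ^ (M - 1) * (\<zeta> * t) powr (s - 1)) * exp (- t))"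
    using x e by (simp add: gamma_density_def ac_simps)
  also have "\<dots> = exp (1 / \<zeta>) / (\<zeta> ^ M * Gamma (real M)) *
      (\<Sum>j = 0..M - 1. real ((M - 1) choose j) * (- 1) ^ (M - 1 - j) * \<zeta> powr (real j + s - 1)
        * (indicator {1 / \<zeta>..} t * (t powr (real j + s - 1) * exp (- t))))"
    unfolding sum using True by (simp add: sum_distrib_right mult.assoc)
  finally show ?thesis .
next
  case False
  then have "-1 + \<zeta> * t < 0"
    using assms by (simp add: field_simps)
  then show ?thesis
    using False by (simp add: gamma_density_def)
qed

lemma has_bochner_integral_gamma_density_powr:
  assumes "\<zeta> > 0"
  shows "has_bochner_integral lborel (\<lambda>x. gamma_density M \<zeta> x * (1 + x) powr (s - 1))
    (exp (1 / \<zeta>) / (\<zeta> ^ M * Gamma (real M)) *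
      (\<Sum>j = 0..M - 1. real ((M - 1) choose j) * (- 1) ^ (M - 1 - j) * \<zeta> powr (real j + s)
        * upper_incomplete_gamma (real j + s) (1 / \<zeta>)))"
    (is "has_bochner_integral _ _ (?C * ?S)")
proof -
  have "has_bochner_integral lborel
      (\<lambda>t. gamma_density M \<zeta> (-1 + \<zeta> * t) * (1 + (-1 + \<zeta> * t)) powr (s - 1))
      (?C * (\<Sum>j = 0..M - 1. real ((M - 1) choose j) * (- 1) ^ (M - 1 - j)
        * \<zeta> powr (real j + s - 1) * upper_incomplete_gamma (real j + s) (1 / \<zeta>)))"
    unfolding gamma_density_substitution[OF assms]
    using assms
    by (intro has_bochner_integral_mult_right has_bochner_integral_sum
        has_bochner_integral_upper_incomplete_gamma) auto
  \<comment> \<open>The \<open>-1\<close> in each exponent of \<open>\<zeta>\<close> comes out of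
    the sum as the factor \<open>1 / \<zeta>\<close>, which is the Jacobian factor in the change of
    variables.\<close>
  also have "?C * (\<Sum>j = 0..M - 1. real ((M - 1) choose j) * (- 1) ^ (M - 1 - j)
        * \<zeta> powr (real j + s - 1) * upper_incomplete_gamma (real j + s) (1 / \<zeta>))
      = (?C * ?S) /\<^sub>R \<bar>\<zeta>\<bar>"
    using assms by (simp add: powr_diff sum_divide_distrib divide_inverse_commute
        sum_distrib_left ac_simps)
  finally show ?thesis
    using assms by (subst lborel_has_bochner_integral_real_affine_iff[of \<zeta> _ _ "-1"]) auto
qed

text \<open>\<open>Gamma (real M)\<close> is the factorial of \<open>M - 1\<close>, which cancels
  the numerator of the binomial coefficient. This is what links the two closed forms.\<close>

lemma binomial_over_Gamma:
  assumes "j < M"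
  shows "real ((M - 1) choose j) / Gamma (real M) =
    1 / (Gamma (real (M - j)) * Gamma (real (j + 1)))"
proof -
  have G: "Gamma (real m) = fact (m - 1)" if "m > 0" for m
    using that Gamma_fact[of "m - 1", where 'a = real] by (simp add: of_nat_diff)
  \<comment> \<open>The deleted rules keep the arguments of \<open>Gamma\<close> as casts of natural
    numbers, the shape that \<open>G\<close> rewrites.\<close>
  show ?thesis
    using assms binomial_fact[of j "M - 1", where 'a = real] by (simp add: G del: of_nat_add of_nat_Suc of_nat_diff)
qed

theorem theorem2:
  fixes P :: "'a measure" and \<gamma> :: "'a \<Rightarrow> real" and g :: "real \<Rightarrow> real"
    and M :: nat and \<zeta> s :: real
  assumes "prob_space P"
    and "M \<ge> 1"
    and "\<zeta> > 0"
    and "distributed P lborel \<gamma> (\<lambda>x. ennreal (gamma_density M \<zeta> x))"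
    and "g = (\<lambda>x. 1 + x)"
  shows "mellin_exists P (\<lambda>\<omega>. g (\<gamma> \<omega>)) s
    \<and> mellin_transform P (\<lambda>\<omega>. g (\<gamma> \<omega>)) s =
      exp (1 / \<zeta>) / (\<zeta> ^ M * Gamma (real M)) *
        (\<Sum>j = 0..M - 1. real ((M - 1) choose j) * (- 1) ^ (M - 1 - j) * \<zeta> powr (real j + s)
           * upper_incomplete_gamma (real j + s) (1 / \<zeta>))
    \<and> mellin_transform P (\<lambda>\<omega>. g (\<gamma> \<omega>)) s =
      exp (1 / \<zeta>) *
        (\<Sum>j = 0..M - 1. (- 1) ^ (M - 1 - j) * \<zeta> powr (real j + s - real M)
           * (upper_incomplete_gamma (real j + s) (1 / \<zeta>)
              / (Gamma (real (M - j)) * Gamma (real (j + 1)))))"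
proof -
  have meas: "(\<lambda>x::real. (1 + x) powr (s - 1)) \<in> borel_measurable lborel"
    by measurable
  have nonneg: "0 \<le> gamma_density M \<zeta> x" for x
    using assms(3) by (rule gamma_density_nonneg)
  note hb = has_bochner_integral_gamma_density_powr[OF assms(3), of M s]
  \<comment> \<open>The law of \<open>\<gamma>\<close> turns integrability over \<open>P\<close>
    into integrability against the density on the real line.\<close>
  have exists: "mellin_exists P (\<lambda>\<omega>. g (\<gamma> \<omega>)) s"
    using hb distributed_integrable[OF assms(4) meas nonneg]
    by (simp add: mellin_exists_def assms(5) has_bochner_integral_iff)
  have first: "mellin_transform P (\<lambda>\<omega>. g (\<gamma> \<omega>)) s =
      exp (1 / \<zeta>) / (\<zeta> ^ M * Gamma (real M)) *
        (\<Sum>j = 0..M - 1. real ((M - 1) choose j) * (- 1) ^ (M - 1 - j) * \<zeta> powr (real j + s)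
           * upper_incomplete_gamma (real j + s) (1 / \<zeta>))"
    using hb distributed_integral[OF assms(4) meas nonneg]
    by (simp add: mellin_transform_def assms(5) has_bochner_integral_iff)
  \<comment> \<open>The prefactor moves into the sum so that \<open>\<zeta> ^ M\<close> meets the
    power of \<open>\<zeta>\<close> and \<open>Gamma (real M)\<close> meets the binomial
    coefficient; each pair then simplifies on its own.\<close>
  also have "\<dots> = exp (1 / \<zeta>) *
        (\<Sum>j = 0..M - 1. (- 1) ^ (M - 1 - j) * (\<zeta> powr (real j + s) / \<zeta> ^ M)
           * (real ((M - 1) choose j) / Gamma (real M)
              * upper_incomplete_gamma (real j + s) (1 / \<zeta>)))"
    by (simp add: sum_distrib_left sum_divide_distrib field_simps)
  also have "\<dots> = exp (1 / \<zeta>) *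
        (\<Sum>j = 0..M - 1. (- 1) ^ (M - 1 - j) * \<zeta> powr (real j + s - real M)
           * (upper_incomplete_gamma (real j + s) (1 / \<zeta>)
              / (Gamma (real (M - j)) * Gamma (real (j + 1)))))"
  proof (intro arg_cong2[where f = "(*)"] sum.cong refl)
    fix j assume "j \<in> {0..M - 1}"
    then have "j < M"
      using assms(2) by auto
    then show "real ((M - 1) choose j) / Gamma (real M)
          * upper_incomplete_gamma (real j + s) (1 / \<zeta>)
        = upper_incomplete_gamma (real j + s) (1 / \<zeta>)
          / (Gamma (real (M - j)) * Gamma (real (j + 1)))"
      by (subst binomial_over_Gamma) auto
  qed (use assms(3) in \<open>simp add: powr_diff powr_realpow\<close>)
  finally show ?thesis
    using exists first by blast
qed

end
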